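(* Let $T\ge 1$, let $\mathcal{L}\colon\mathbb{R}^{n_x}\times\mathbb{R}^{n_w}\to\mathbb{R}$, and for $t=1,\dots,T$ let $\mathbb{P}_t$ be a probability distribution on $\mathbb{R}^{n_w}$ with support set $\Omega_t$, and $\mathcal{F}_t(\bm{x})=\mathbb{E}_{\bm{w}\sim\mathbb{P}_t}\mathcal{L}(\bm{x},\bm{w})$, with $\mathcal{F}_t^*=\min_{\bm{x}}\mathcal{F}_t(\bm{x})$. Let $\bm{x}_1\in\mathbb{R}^{n_x}$ and let $\bm{x}_{t+1}=\bm{x}_t-\gamma_t\widehat{\nabla}\mathcal{F}_t(\bm{x}_t;\bm{w}_1^t,\dots,\bm{w}_m^t)$ for $t=1,\dots,T-1$ (online stochastic gradient descent), where $\bm{w}_1^t,\dots,\bm{w}_m^t$ are samples drawn independently from $\mathbb{P}_t$ and $\widehat{\nabla}\mathcal{F}_t$ is a gradient approximation. Suppose the following hold. 1. For every $\bm{x}\in\mathbb{R}^{n_x}$ and $t=1,\dots,T$: $\mathcal{L}(\bm{x},\cdot)$ is measurable; $\mathcal{F}_t(\bm{x})$ is well-defined and finite valued; there is a positive valued random variable $C(\bm{w})$ with $\mathbb{E}_{\bm{w}\sim\mathbb{P}_t}[C(\bm{w})]<\infty$ such that $|\mathcal{L}(\bm{x}_1,\bm{w})-\mathcal{L}(\bm{x}_2,\bm{w})|\le C(\bm{w})\|\bm{x}_1-\bm{x}_2\|$ for all $\bm{x}_1,\bm{x}_2$ in a neighborhood of $\bm{x}$ and almost every $\bm{w}\in\Omega_t$;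 and for almost every $\bm{w}\in\Omega_t$ the function $\mathcal{L}(\cdot,\bm{w})$ is differentiable at $\bm{x}$. 2. Each $\Omega_t$ is bounded, $t=1,\dots,T$. 3. For $t=1,\dots,T$, $\mathbb{E}_{\bm{w}_1^t,\dots,\bm{w}_m^t}[\widehat{\nabla}\mathcal{F}_t(\bm{x};\bm{w}_1^t,\dots,\bm{w}_m^t)]=\nabla\mathcal{F}_t(\bm{x})$ and $\mathbb{E}_{\bm{w}_1^t,\dots,\bm{w}_m^t}[\|\widehat{\nabla}\mathcal{F}_t(\bm{x}_t;\bm{w}_1^t,\dots,\bm{w}_m^t)-\nabla\mathcal{F}_t(\bm{x}_t)\|^2]\le\sigma_t^2$ for some $\sigma_t>0$. 4. For $t=1,\dots,T-1$, $\mathfrak{M}(\mathbb{P}_{t+1},\mathbb{P}_t)\le\eta_t$ for some $\eta_t>0$. 5. For $t=1,\dots,T$, $\mathcal{F}_t$ is $\beta$-smooth: $\|\nabla\mathcal{F}_t(\bm{y})-\nabla\mathcal{F}_t(\bm{x})\|\le\beta\|\bm{y}-\bm{x}\|$ for all $\bm{x},\bm{y}\in\mathbb{R}^{n_x}$. 6. For $t=1,\dots,T$, $\mathcal{F}_t$ satisfies the Polyak-Łojasiewicz condition on a set $\mathcal{X}$ with constant $\mu>0$; i.e., $\frac12\|\nabla\mathcal{F}_t(\bm{x})\|^2\ge\mu(\mathcal{F}_t(\bm{x})-\mathcal{F}_t^* )$ for all $\bm{x}\in\mathcal{X}$. 7. For each $\bm{x}\in\mathbb{R}^{n_x}$ there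 is a constant $K_w(\bm{x})$ with $|\mathcal{L}(\bm{x},\bm{w})-\mathcal{L}(\bm{x},\bm{w}')|\le K_w(\bm{x})\|\bm{w}-\bm{w}'\|$ for all $\bm{w},\bm{w}'\in\mathbb{R}^{n_w}$, and $K=\max_{\bm{x}}K_w(\bm{x})<\infty$. 8. There is an increasing function $J\colon\mathbb{R}_+\to\mathbb{R}_+$ such that $\|\mathbb{E}_{\bm{w}\sim\mathbb{P}_{t+1}}[\nabla_{\bm{x}}\mathcal{L}(\bm{x},\bm{w})]-\mathbb{E}_{\bm{w}\sim\mathbb{P}_t}[\nabla_{\bm{x}}\mathcal{L}(\bm{x},\bm{w})]\|\le J(\eta_t)$ for all $\bm{x}\in\mathbb{R}^{n_x}$ and $t=1,\dots,T-1$. Suppose the step size satisfies $\gamma_t\equiv\gamma\in(0,\min(1/\beta,1/(2\mu)))$, and let $\zeta=-\frac{\gamma^2\beta}{2}+\gamma$. Then $$\mathrm{Regret}(T)\le\frac{1}{2\mu\zeta}(\mathcal{F}_1(\bm{x}_1)-\mathcal{F}_1^* )+\frac{K}{\mu\zeta}\sum_{t=1}^{T-1}\eta_t+\frac{1}{4\mu^2\zeta}\sum_{t=1}^{T-1}J(\eta_t)^2+\frac{\gamma\beta}{2\mu}\sum_{t=1}^{T-1}\sigma_t^2.$$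
   Context: $\|\cdot\|$ is the Euclidean norm. The dynamic regret is $\mathrm{Regret}(T)=\sum_{t=1}^T\mathbb{E}_{\{\bm{w}_1^\tau,\dots,\bm{w}_m^\tau\}_{\tau=1}^{t-1}}[\mathcal{F}_t(\bm{x}_t)-\mathcal{F}_t^*]$. Standing assumptions: each $\mathcal{F}_t$ is continuously differentiable and $\mathcal{L}(\bm{x},\bm{w})$ is differentiable with respect to $\bm{x}$ for $\mathbb{P}_t$-almost every $\bm{w}$. The type-1 Wasserstein distance between distributions $\mathbb{P},\mathbb{Q}$ on $\mathbb{R}^{n_w}$ with finite first moments is $\mathfrak{M}(\mathbb{P},\mathbb{Q})=\inf_{\Pi\in\mathcal{J}(\mathbb{P},\mathbb{Q})}\int_{\mathbb{R}^{n_w}\times\mathbb{R}^{n_w}}\|\xi_1-\xi_2\|\,\Pi(d\xi_1,d\xi_2)$, where $\mathcal{J}(\mathbb{P},\mathbb{Q})$ is the set of joint distributions with marginals $\mathbb{P}$ and $\mathbb{Q}$.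
   Formalization: The formal theorem adds the hypothesis that the iterates x_t, t=1,…,T, lie almost surely in the set 𝒳 of the Polyak-Łojasiewicz condition; without it (e.g. 𝒳 empty) the bound is false. *)

theory Defs
  imports "HOL-Probability.Probability"
begin

text \<open>Outside the points of differentiability the value of \<open>grad f\<close> is an unspecified constant.\<close>

definition grad :: "('a::real_inner \<Rightarrow> real) \<Rightarrow> 'a \<Rightarrow> 'a" where
  "grad f x = (THE D. GDERIV f x :> D)"

lemma grad_eqI:
  assumes "GDERIV f x :> D"
  shows "grad f x = D"
  unfolding grad_def
proof (rule the_equality)
  show "GDERIV f x :> D" by fact
next
  fix D' assume "GDERIV f x :> D'"
  with assms have "(\<lambda>h. inner h D') = (\<lambda>h. inner h D)"
    unfolding gderiv_def by (rule has_derivative_unique[rotated])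
  then have "inner (D' - D) (D' - D) = 0"
    by (metis inner_diff_right right_minus_eq)
  then show "D' = D" by simp
qed

lemma GDERIV_grad:
  fixes f :: "'a::euclidean_space \<Rightarrow> real"
  assumes "f differentiable (at x)"
  shows "GDERIV f x :> grad f x"
proof -
  from assms obtain f' where f': "(f has_derivative f') (at x)"
    by (auto simp: differentiable_def)
  interpret bounded_linear f' using f' by (rule has_derivative_bounded_linear)
  have "f' = (\<lambda>h. inner h (\<Sum>b\<in>Basis. f' b *\<^sub>R b))"
  proof
    fix h
    have "f' h = f' (\<Sum>b\<in>Basis. (h \<bullet> b) *\<^sub>R b)"
      by (simp add: euclidean_representation)
    also have "\<dots> = inner h (\<Sum>b\<in>Basis. f' b *\<^sub>R b)"
      by (simp add: sum scaleR inner_sum_right mult.commute)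
    finally show "f' h = inner h (\<Sum>b\<in>Basis. f' b *\<^sub>R b)" .
  qed
  with f' have "GDERIV f x :> (\<Sum>b\<in>Basis. f' b *\<^sub>R b)"
    unfolding gderiv_def by simp
  with grad_eqI[OF this] show ?thesis by simp
qed

definition msupport :: "'a::topological_space measure \<Rightarrow> 'a set" where
  "msupport P = {w. \<forall>U. open U \<and> w \<in> U \<longrightarrow> emeasure P U > 0}"

definition couplings :: "'a measure \<Rightarrow> 'b measure \<Rightarrow> ('a \<times> 'b) measure set" where
  "couplings P Q = {R. sets R = sets (P \<Otimes>\<^sub>M Q) \<and> distr R P fst = P \<and> distr R Q snd = Q}"

definition wasserstein1 :: "'a::real_normed_vector measure \<Rightarrow> 'a measure \<Rightarrow> ennreal" where
  "wasserstein1 P Q = (INF R\<in>couplings P Q. \<integral>\<^sup>+ (\<xi>1, \<xi>2). ennreal (norm (\<xi>1 - \<xi>2)) \<partial>R)"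

text \<open>Each \<open>x t\<close> is a random variable on \<open>M\<close>; \<open>Fstar t\<close> stands for the minimum of \<open>F t\<close>.\<close>

definition dynamic_regret ::
  "'o measure \<Rightarrow> (nat \<Rightarrow> 'a \<Rightarrow> real) \<Rightarrow> (nat \<Rightarrow> real) \<Rightarrow> (nat \<Rightarrow> 'o \<Rightarrow> 'a) \<Rightarrow> nat \<Rightarrow> real" where
  "dynamic_regret M F Fstar x T = (\<Sum>t=1..T. \<integral>\<omega>. F t (x t \<omega>) - Fstar t \<partial>M)"

text \<open>
  Conventions used when stating results about online stochastic gradient descent:
  \<^item> All samples live on one probability space \<open>M\<close>; \<open>W t i\<close> is the \<open>i\<close>-th sample of round \<open>t\<close>.
    Since \<open>x t\<close> is a function of the samples of rounds \<open>1, \<dots>, t - 1\<close>, the expectation over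
    these samples is the expectation over \<open>M\<close>.
  \<^item> A gradient approximation \<open>g t x w\<close> takes the batch \<open>w\<close> as an extensional function on
    \<open>{1..m}\<close>; the law of the batch of round \<open>t\<close> is the product measure \<open>PiM {1..m} (\<lambda>_. P t)\<close>.
  \<^item> Expectations of \<open>grad (\<lambda>y. L y w) x\<close> over \<open>w\<close> are taken over the completion of \<open>P t\<close>: for fixed
    \<open>x\<close> the gradient exists only almost everywhere, and it need not be Borel measurable on
    the exceptional null set.
\<close>

end

theory Submission
  imports Defs
begin

text \<open>
  The regret obeys a contracting recursion. Write \<open>D t\<close> for the expectation of
  \<open>F t (x t) - Fstar t\<close>. Two things happen between \<open>D t\<close> and \<open>D (Suc t)\<close>.

  \<^item> The iterate moves while the objective stays. By smoothness, one step of length \<open>\<gamma>\<close> along an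
    unbiased gradient estimate of variance at most \<open>\<sigma>\<^sup>2\<close> changes the expected value of \<open>F t\<close> by at
    most \<open>\<gamma>\<^sup>2 * \<beta> / 2 * \<sigma>\<^sup>2\<close> minus \<open>\<zeta>\<close> times the expected squared gradient norm
    (\<open>stochastic_gradient_step\<close>). By the Polyak--Lojasiewicz inequality that squared norm is at
    least \<open>2 * \<mu> * D t\<close> in expectation.
  \<^item> The objective moves while the iterate stays. As \<open>L y\<close> is \<open>K\<close>-Lipschitz in \<open>w\<close>, transporting
    \<open>P t\<close> to \<open>P (Suc t)\<close> changes \<open>F t y\<close> by at most \<open>K * \<eta> t\<close>, uniformly in \<open>y\<close>
    (\<open>integral_diff_le_wasserstein1\<close>). The same bound then holds for the minimal values, so the
    drift costs \<open>2 * K * \<eta> t\<close> altogether.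

  Hence \<open>D (Suc t) \<le> (1 - 2 * \<mu> * \<zeta>) * D t + 2 * K * \<eta> t + \<gamma>\<^sup>2 * \<beta> / 2 * \<sigma>\<^sup>2\<close>. The upper bound
  on \<open>\<gamma>\<close> makes the factor nonnegative, and summing over \<open>t\<close> gives a bound on
  \<open>2 * \<mu> * \<zeta>\<close> times the regret (\<open>sum_le_of_contraction\<close>). The variance term takes its stated form
  because \<open>\<gamma> \<le> 2 * \<zeta>\<close>. The summand with \<open>J\<close> is nonnegative, so adding it only enlarges the bound.

  Two points of probability theory carry this. First, conditioning on \<open>x t\<close> must leave the law of
  the fresh batch unchanged: \<open>x t\<close> is a measurable function of the samples of earlier rounds, so
  the pair of \<open>x t\<close> and the batch has a product law
  (\<open>recursion_joint_law_with_next_batch\<close>) and Fubini applies. Second, all expectations must exist.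
  Smooth functions that are bounded below grow at most quadratically, so it suffices that every
  iterate is square integrable, which one gradient step preserves.
\<close>

section \<open>Smooth functions\<close>

text \<open>
  Along the segment from \<open>y\<close> to \<open>y + h\<close> the function minus its claimed quadratic majorant has a
  nonpositive derivative, by Cauchy--Schwarz and the Lipschitz bound on the gradient.
\<close>
lemma smooth_quadratic_upper_bound:
  fixes f :: "'a::real_inner \<Rightarrow> real"
  assumes grad: "\<And>y. GDERIV f y :> G y"
    and lip: "\<And>y z. norm (G z - G y) \<le> \<beta> * norm (z - y)"
  shows "f (y + h) \<le> f y + inner (G y) h + \<beta> / 2 * (norm h)\<^sup>2"
proof -
  define \<phi> where "\<phi> s = f (y + s *\<^sub>R h) - s * inner (G y) h - \<beta> / 2 * s\<^sup>2 * (norm h)\<^sup>2" for s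
  define \<phi>' where "\<phi>' s = inner h (G (y + s *\<^sub>R h)) - inner (G y) h - \<beta> * s * (norm h)\<^sup>2" for s
  have line: "((\<lambda>s. f (y + s *\<^sub>R h)) has_real_derivative inner h (G (y + s *\<^sub>R h))) (at s)" for s
  proof -
    have "((\<lambda>s. y + s *\<^sub>R h) has_derivative (\<lambda>k. k *\<^sub>R h)) (at s)"
      by (auto intro!: derivative_eq_intros)
    then have "((\<lambda>s. f (y + s *\<^sub>R h)) has_derivative (\<lambda>k. inner (k *\<^sub>R h) (G (y + s *\<^sub>R h)))) (at s)"
      using grad[of "y + s *\<^sub>R h"] unfolding gderiv_def by (rule has_derivative_compose)
    moreover have "(\<lambda>k. inner (k *\<^sub>R h) (G (y + s *\<^sub>R h))) = (*) (inner h (G (y + s *\<^sub>R h)))"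
      by (simp add: fun_eq_iff)
    ultimately show ?thesis
      by (simp only: has_field_derivative_def)
  qed
  have deriv: "(\<phi> has_real_derivative \<phi>' s) (at s)" for s
    unfolding \<phi>_def[abs_def] \<phi>'_def by (rule derivative_eq_intros line refl | simp)+
  have nonpos: "\<phi>' s \<le> 0" if "0 \<le> s" for s
  proof -
    have "inner h (G (y + s *\<^sub>R h) - G y) \<le> norm h * norm (G (y + s *\<^sub>R h) - G y)"
      by (rule norm_cauchy_schwarz)
    also have "\<dots> \<le> norm h * (\<beta> * norm (s *\<^sub>R h))"
      using lip[of "y + s *\<^sub>R h" y] by (intro mult_left_mono) auto
    also have "\<dots> = \<beta> * s * (norm h)\<^sup>2"
      using that by (simp add: power2_eq_square)
    finally show ?thesis
      by (simp add: \<phi>'_def inner_diff_right inner_commute)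
  qed
  have "\<phi> 1 \<le> \<phi> 0"
    by (rule DERIV_nonpos_imp_nonincreasing) (use deriv nonpos in auto)
  then show ?thesis by (simp add: \<phi>_def)
qed

lemma GDERIV_imp_continuous_on:
  assumes "\<And>y. GDERIV f y :> G y"
  shows "continuous_on UNIV f"
  using assms unfolding gderiv_def
  by (meson continuous_at_imp_continuous_on has_derivative_continuous)

lemma Lipschitz_imp_continuous_on:
  fixes G :: "'a::real_normed_vector \<Rightarrow> 'b::real_normed_vector"
  assumes "\<And>y z. norm (G z - G y) \<le> \<beta> * norm (z - y)"
  shows "continuous_on UNIV G"
proof -
  \<comment> \<open>Lipschitz constants are nonnegative by definition; \<open>\<beta>\<close> may be negative if the domain is trivial.\<close>
  have "(max \<beta> 0)-lipschitz_on UNIV G"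
  proof (rule lipschitz_onI)
    fix y z :: 'a
    have "\<beta> * norm (y - z) \<le> max \<beta> 0 * norm (y - z)" by (intro mult_right_mono) auto
    then show "dist (G y) (G z) \<le> max \<beta> 0 * dist y z"
      using assms[of y z] by (simp add: dist_norm)
  qed simp
  then show ?thesis by (rule lipschitz_on_continuous_on)
qed

lemma (in prob_space) integrable_norm_square_Lipschitz:
  fixes G :: "'b::euclidean_space \<Rightarrow> 'c::euclidean_space"
  assumes Z[measurable]: "Z \<in> borel_measurable M"
    and sq: "integrable M (\<lambda>\<omega>. (norm (Z \<omega>))\<^sup>2)"
    and lip: "\<And>y z. norm (G z - G y) \<le> \<beta> * norm (z - y)"
  shows "integrable M (\<lambda>\<omega>. (norm (G (Z \<omega>)))\<^sup>2)"
proof -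
  have [measurable]: "G \<in> borel_measurable borel"
    using Lipschitz_imp_continuous_on[OF lip] by (rule borel_measurable_continuous_onI)
  show ?thesis
  proof (rule Bochner_Integration.integrable_bound)
    show "integrable M (\<lambda>\<omega>. 2 * (norm (G 0))\<^sup>2 + 2 * \<beta>\<^sup>2 * (norm (Z \<omega>))\<^sup>2)"
      using sq by simp
    have "(norm (G z))\<^sup>2 \<le> 2 * (norm (G 0))\<^sup>2 + 2 * \<beta>\<^sup>2 * (norm z)\<^sup>2" for z
    proof -
      have "norm (G z) \<le> norm (G 0) + \<beta> * norm z"
        using lip[of z 0] norm_triangle_sub[of "G z" "G 0"] by simp
      then have "(norm (G z))\<^sup>2 \<le> (norm (G 0) + \<beta> * norm z)\<^sup>2"
        by (intro power_mono) auto
      also have "\<dots> \<le> 2 * (norm (G 0))\<^sup>2 + 2 * (\<beta> * norm z)\<^sup>2"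
        using sum_squares_bound[of "norm (G 0)" "\<beta> * norm z"] by (simp add: power2_sum)
      finally show ?thesis by (simp add: power_mult_distrib)
    qed
    then show "AE \<omega> in M. norm ((norm (G (Z \<omega>)))\<^sup>2)
        \<le> norm (2 * (norm (G 0))\<^sup>2 + 2 * \<beta>\<^sup>2 * (norm (Z \<omega>))\<^sup>2)"
      by (auto intro!: always_eventually order_trans[OF _ abs_ge_self])
  qed measurable
qed

text \<open>
  The quadratic upper bound at \<open>0\<close> together with the constant lower bound gives quadratic growth.
\<close>
lemma (in prob_space) integrable_smooth_bounded_below:
  fixes f :: "'b::euclidean_space \<Rightarrow> real"
  assumes Z[measurable]: "Z \<in> borel_measurable M"
    and sq: "integrable M (\<lambda>\<omega>. (norm (Z \<omega>))\<^sup>2)"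
    and grad: "\<And>y. GDERIV f y :> G y"
    and lip: "\<And>y z. norm (G z - G y) \<le> \<beta> * norm (z - y)"
    and below: "\<And>y. c \<le> f y"
  shows "integrable M (\<lambda>\<omega>. f (Z \<omega>))"
proof -
  have [measurable]: "f \<in> borel_measurable borel"
    using GDERIV_imp_continuous_on[OF grad] by (rule borel_measurable_continuous_onI)
  \<comment> \<open>The term linear in \<open>z\<close> is absorbed by \<open>2 * a * b \<le> a\<^sup>2 + b\<^sup>2\<close>.\<close>
  define B where "B z = \<bar>c\<bar> + \<bar>f 0\<bar> + (norm (G 0))\<^sup>2 + (1 + \<bar>\<beta>\<bar> / 2) * (norm z)\<^sup>2" for z :: 'b
  have bound: "\<bar>f z\<bar> \<le> B z" for z
  proof -
    have "f z \<le> f 0 + inner (G 0) z + \<beta> / 2 * (norm z)\<^sup>2"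
      using smooth_quadratic_upper_bound[OF grad lip, of 0 z] by simp
    moreover have "inner (G 0) z \<le> norm (G 0) * norm z" by (rule norm_cauchy_schwarz)
    moreover have "2 * (norm (G 0) * norm z) \<le> (norm (G 0))\<^sup>2 + (norm z)\<^sup>2"
      using sum_squares_bound[of "norm (G 0)" "norm z"] by simp
    moreover have "\<beta> / 2 * (norm z)\<^sup>2 \<le> \<bar>\<beta>\<bar> / 2 * (norm z)\<^sup>2"
      by (intro mult_right_mono) auto
    moreover have "0 \<le> \<bar>\<beta>\<bar> / 2 * (norm z)\<^sup>2" "0 \<le> norm (G 0) * norm z" by auto
    moreover have "(1 + \<bar>\<beta>\<bar> / 2) * (norm z)\<^sup>2 = (norm z)\<^sup>2 + \<bar>\<beta>\<bar> / 2 * (norm z)\<^sup>2"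
      by (simp add: algebra_simps)
    ultimately show ?thesis
      using below[of z] unfolding B_def by linarith
  qed
  show ?thesis
  proof (rule Bochner_Integration.integrable_bound)
    show "integrable M (\<lambda>\<omega>. B (Z \<omega>))" unfolding B_def using sq by simp
    show "AE \<omega> in M. norm (f (Z \<omega>)) \<le> norm (B (Z \<omega>))"
      using bound by (auto intro!: always_eventually order_trans[OF _ abs_ge_self])
  qed measurable
qed

section \<open>Wasserstein distance and Lipschitz integrands\<close>

text \<open>
  This is the easy half of Kantorovich--Rubinstein duality: any coupling turns the difference of
  the two integrals into one integral of \<open>\<psi> \<xi>1 - \<psi> \<xi>2\<close>, which is at most \<open>K\<close> times the transport
  cost. The infimum over couplings need not be attained, hence the slack \<open>e\<close> in the proof.
\<close>
lemma integral_diff_le_wasserstein1: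
  fixes P Q :: "('a::euclidean_space) measure"
  assumes P: "sets P = sets borel" and Q: "sets Q = sets borel"
    and \<psi>: "integrable P \<psi>" "integrable Q \<psi>"
    and lip: "\<And>w w'. \<bar>\<psi> w - \<psi> w'\<bar> \<le> K * norm (w - w')" and K: "0 \<le> (K::real)"
    and W: "wasserstein1 P Q \<le> ennreal \<eta>" and \<eta>: "0 \<le> \<eta>"
  shows "\<bar>(\<integral>w. \<psi> w \<partial>P) - (\<integral>w. \<psi> w \<partial>Q)\<bar> \<le> K * \<eta>"
proof (rule field_le_epsilon)
  fix e :: real assume "0 < e"
  \<comment> \<open>The denominator is \<open>K + 1\<close> since \<open>K\<close> may be \<open>0\<close>.\<close>
  define d where "d = e / (K + 1)"
  have d: "0 < d" using \<open>0 < e\<close> K by (simp add: d_def)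
  have "wasserstein1 P Q < ennreal (\<eta> + d)"
    using d \<eta> by (intro le_less_trans[OF W]) (simp add: ennreal_less_iff)
  then obtain R where R: "R \<in> couplings P Q"
    and cost: "(\<integral>\<^sup>+ (\<xi>1, \<xi>2). ennreal (norm (\<xi>1 - \<xi>2)) \<partial>R) < ennreal (\<eta> + d)"
    unfolding wasserstein1_def by (auto simp: INF_less_iff)
  have sR: "sets R = sets (P \<Otimes>\<^sub>M Q)" and mP: "distr R P fst = P" and mQ: "distr R Q snd = Q"
    using R by (auto simp: couplings_def)
  have fst_R[measurable]: "fst \<in> measurable R P" and snd_R[measurable]: "snd \<in> measurable R Q"
    unfolding measurable_cong_sets[OF sR refl] by auto
  have [measurable]: "fst \<in> measurable R borel" "snd \<in> measurable R borel"
    using fst_R[unfolded measurable_cong_sets[OF refl P]]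
      snd_R[unfolded measurable_cong_sets[OF refl Q]] .
  have int_norm: "integrable R (\<lambda>z. norm (fst z - snd z))"
  proof (rule integrableI_bounded)
    show "(\<integral>\<^sup>+ z. ennreal (norm (norm (fst z - snd z))) \<partial>R) < \<infinity>"
      using less_trans[OF cost ennreal_less_top] by (simp add: case_prod_beta')
  qed measurable
  have le_norm: "(\<integral>z. norm (fst z - snd z) \<partial>R) \<le> \<eta> + d"
  proof -
    have "ennreal (\<integral>z. norm (fst z - snd z) \<partial>R) = (\<integral>\<^sup>+ z. ennreal (norm (fst z - snd z)) \<partial>R)"
      using int_norm by (intro nn_integral_eq_integral[symmetric]) auto
    also have "\<dots> \<le> ennreal (\<eta> + d)" using cost by (simp add: case_prod_beta')
    finally show ?thesis using d \<eta> by (subst (asm) ennreal_le_iff) auto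
  qed
  have int1: "integrable R (\<lambda>z. \<psi> (fst z))" and int2: "integrable R (\<lambda>z. \<psi> (snd z))"
    using integrable_distr[OF fst_R, of \<psi>] integrable_distr[OF snd_R, of \<psi>] \<psi> mP mQ by auto
  have "(\<integral>w. \<psi> w \<partial>P) = (\<integral>z. \<psi> (fst z) \<partial>R)"
    using integral_distr[OF fst_R, of \<psi>] \<psi> mP by (simp add: borel_measurable_integrable)
  moreover have "(\<integral>w. \<psi> w \<partial>Q) = (\<integral>z. \<psi> (snd z) \<partial>R)"
    using integral_distr[OF snd_R, of \<psi>] \<psi> mQ by (simp add: borel_measurable_integrable)
  ultimately have "\<bar>(\<integral>w. \<psi> w \<partial>P) - (\<integral>w. \<psi> w \<partial>Q)\<bar> = \<bar>\<integral>z. \<psi> (fst z) - \<psi> (snd z) \<partial>R\<bar>"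
    using int1 int2 by simp
  also have "\<dots> \<le> (\<integral>z. \<bar>\<psi> (fst z) - \<psi> (snd z)\<bar> \<partial>R)" by (rule integral_abs_bound)
  also have "\<dots> \<le> (\<integral>z. K * norm (fst z - snd z) \<partial>R)"
    using int1 int2 int_norm lip by (intro integral_mono) auto
  also have "\<dots> \<le> K * (\<eta> + d)" using le_norm K by (simp add: mult_left_mono)
  also have "\<dots> \<le> K * \<eta> + e"
  proof -
    have "K * d \<le> (K + 1) * d" using d by simp
    also have "\<dots> = e" using K by (simp add: d_def)
    finally show ?thesis by (simp add: algebra_simps)
  qed
  finally show "\<bar>(\<integral>w. \<psi> w \<partial>P) - (\<integral>w. \<psi> w \<partial>Q)\<bar> \<le> K * \<eta> + e" .
qed

section \<open>One stochastic gradient step\<close>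

text \<open>
  Here \<open>\<nu>\<close> is the law of the current iterate and \<open>Q\<close> the law of the batch. Split \<open>g = G + N\<close> into
  gradient and noise and insert the step into the quadratic upper bound. The mixed term has
  integral zero since \<open>N\<close> is centred for each fixed iterate, and the squared noise
  integrates to at most \<open>\<sigma>\<^sup>2\<close>. The first conclusion is what makes the estimate iterable: square
  integrability of the iterate is inherited by its successor.
\<close>
lemma stochastic_gradient_step:
  fixes f :: "'a::euclidean_space \<Rightarrow> real" and g :: "'a \<Rightarrow> 'b \<Rightarrow> 'a"
  assumes \<nu>: "prob_space \<nu>" "sets \<nu> = sets borel" and Q: "prob_space Q"
    and g: "(\<lambda>(y, w). g y w) \<in> borel_measurable (\<nu> \<Otimes>\<^sub>M Q)"
    and grad: "\<And>y. GDERIV f y :> G y"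
    and lip: "\<And>y z. norm (G z - G y) \<le> \<beta> * norm (z - y)" and \<beta>: "0 \<le> \<beta>"
    and below: "\<And>y. c \<le> f y"
    and unbiased: "\<And>y. has_bochner_integral Q (g y) (G y)"
    and variance: "AE y in \<nu>. (\<integral>\<^sup>+ w. ennreal ((norm (g y w - G y))\<^sup>2) \<partial>Q) \<le> ennreal (\<sigma>\<^sup>2)"
    and sq: "integrable \<nu> (\<lambda>y. (norm y)\<^sup>2)"
  shows "integrable (\<nu> \<Otimes>\<^sub>M Q) (\<lambda>(y, w). (norm (y - \<gamma> *\<^sub>R g y w))\<^sup>2)" (is ?I)
    and "(\<integral>(y, w). f (y - \<gamma> *\<^sub>R g y w) \<partial>(\<nu> \<Otimes>\<^sub>M Q))
      \<le> (\<integral>y. f y \<partial>\<nu>) - (\<gamma> - \<gamma>\<^sup>2 * \<beta> / 2) * (\<integral>y. (norm (G y))\<^sup>2 \<partial>\<nu>) + \<gamma>\<^sup>2 * \<beta> / 2 * \<sigma>\<^sup>2"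
proof -
  interpret \<nu>: prob_space \<nu> by fact
  interpret Q: prob_space Q by fact
  interpret pair: pair_prob_space \<nu> Q ..
  note g[measurable]
  have id_\<nu>[measurable]: "(\<lambda>y. y) \<in> borel_measurable \<nu>"
    by (rule measurable_ident_sets[OF \<nu>(2)])
  have fst[measurable]: "fst \<in> borel_measurable (\<nu> \<Otimes>\<^sub>M Q)"
    using measurable_comp[OF measurable_fst id_\<nu>] by (simp add: comp_def)
  have G_meas[measurable]: "G \<in> borel_measurable borel"
    using Lipschitz_imp_continuous_on[OF lip] by (rule borel_measurable_continuous_onI)
  have f_meas[measurable]: "f \<in> borel_measurable borel"
    using GDERIV_imp_continuous_on[OF grad] by (rule borel_measurable_continuous_onI)
  define N where "N = (\<lambda>z. g (fst z) (snd z) - G (fst z))"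
  have [measurable]: "(\<lambda>z. g (fst z) (snd z)) \<in> borel_measurable (\<nu> \<Otimes>\<^sub>M Q)"
    using g by (simp add: case_prod_beta')
  have N_meas[measurable]: "N \<in> borel_measurable (\<nu> \<Otimes>\<^sub>M Q)"
    unfolding N_def by measurable
  have int_fst: "integrable (\<nu> \<Otimes>\<^sub>M Q) (\<lambda>z. h (fst z))"
    and integral_fst: "(\<integral>z. h (fst z) \<partial>(\<nu> \<Otimes>\<^sub>M Q)) = (\<integral>y. h y \<partial>\<nu>)"
    if "integrable \<nu> h" for h :: "'a \<Rightarrow> real"
  proof -
    have d: "distr (\<nu> \<Otimes>\<^sub>M Q) \<nu> fst = \<nu>" by (rule Q.distr_pair_fst)
    show "integrable (\<nu> \<Otimes>\<^sub>M Q) (\<lambda>z. h (fst z))"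
      using integrable_distr[of fst "\<nu> \<Otimes>\<^sub>M Q" \<nu> h] that d by simp
    show "(\<integral>z. h (fst z) \<partial>(\<nu> \<Otimes>\<^sub>M Q)) = (\<integral>y. h y \<partial>\<nu>)"
      using integral_distr[of fst "\<nu> \<Otimes>\<^sub>M Q" \<nu> h] that d by (simp add: borel_measurable_integrable)
  qed
  have f_int: "integrable \<nu> f"
    by (rule \<nu>.integrable_smooth_bounded_below[OF id_\<nu> sq grad lip below])
  have G_int: "integrable \<nu> (\<lambda>y. (norm (G y))\<^sup>2)"
    by (rule \<nu>.integrable_norm_square_Lipschitz[OF id_\<nu> sq lip])
  have N_nn: "(\<integral>\<^sup>+ z. ennreal ((norm (N z))\<^sup>2) \<partial>(\<nu> \<Otimes>\<^sub>M Q)) \<le> ennreal (\<sigma>\<^sup>2)"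
  proof -
    have "(\<integral>\<^sup>+ z. ennreal ((norm (N z))\<^sup>2) \<partial>(\<nu> \<Otimes>\<^sub>M Q))
        = (\<integral>\<^sup>+ y. \<integral>\<^sup>+ w. ennreal ((norm (N (y, w)))\<^sup>2) \<partial>Q \<partial>\<nu>)"
      by (rule Q.nn_integral_fst[symmetric]) measurable
    also have "\<dots> \<le> (\<integral>\<^sup>+ y. ennreal (\<sigma>\<^sup>2) \<partial>\<nu>)"
      using variance by (intro nn_integral_mono_AE) (simp add: N_def)
    also have "\<dots> = ennreal (\<sigma>\<^sup>2)" by (simp add: \<nu>.emeasure_space_1)
    finally show ?thesis .
  qed
  have N_int: "integrable (\<nu> \<Otimes>\<^sub>M Q) (\<lambda>z. (norm (N z))\<^sup>2)"
    using N_nn by (intro integrableI_bounded) (auto intro: le_less_trans)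
  have N_le: "(\<integral>z. (norm (N z))\<^sup>2 \<partial>(\<nu> \<Otimes>\<^sub>M Q)) \<le> \<sigma>\<^sup>2"
  proof -
    have "ennreal (\<integral>z. (norm (N z))\<^sup>2 \<partial>(\<nu> \<Otimes>\<^sub>M Q)) \<le> ennreal (\<sigma>\<^sup>2)"
      using N_nn nn_integral_eq_integral[OF N_int] by simp
    then show ?thesis by (subst (asm) ennreal_le_iff) auto
  qed
  have GN_int: "integrable (\<nu> \<Otimes>\<^sub>M Q) (\<lambda>z. inner (G (fst z)) (N z))"
  proof (rule Bochner_Integration.integrable_bound)
    show "integrable (\<nu> \<Otimes>\<^sub>M Q) (\<lambda>z. (norm (G (fst z)))\<^sup>2 + (norm (N z))\<^sup>2)"
      using int_fst[OF G_int] N_int by simp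
    have "\<bar>inner (G (fst z)) (N z)\<bar> \<le> (norm (G (fst z)))\<^sup>2 + (norm (N z))\<^sup>2" for z
      using Cauchy_Schwarz_ineq2[of "G (fst z)" "N z"]
        sum_squares_bound[of "norm (G (fst z))" "norm (N z)"]
        mult_nonneg_nonneg[OF norm_ge_zero[of "G (fst z)"] norm_ge_zero[of "N z"]] by linarith
    then show "AE z in \<nu> \<Otimes>\<^sub>M Q. norm (inner (G (fst z)) (N z))
        \<le> norm ((norm (G (fst z)))\<^sup>2 + (norm (N z))\<^sup>2)"
      by (auto intro!: always_eventually order_trans[OF _ abs_ge_self])
  qed measurable
  have GN_zero: "(\<integral>z. inner (G (fst z)) (N z) \<partial>(\<nu> \<Otimes>\<^sub>M Q)) = 0"
  proof -
    have "(\<integral>w. inner (G y) (N (y, w)) \<partial>Q) = 0" for y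
    proof -
      have i: "integrable Q (g y)" and e: "(\<integral>w. g y w \<partial>Q) = G y"
        using unbiased[of y] by (auto simp: has_bochner_integral_iff)
      have "(\<integral>w. inner (G y) (g y w - G y) \<partial>Q) = inner (G y) (\<integral>w. g y w - G y \<partial>Q)"
        using i by (intro integral_inner_right) auto
      also have "(\<integral>w. g y w - G y \<partial>Q) = 0" using i e by (simp add: Q.prob_space)
      finally show ?thesis by (simp add: N_def)
    qed
    then show ?thesis
      using pair.integral_fst'[OF GN_int] by simp
  qed
  have step_sq: "integrable (\<nu> \<Otimes>\<^sub>M Q) (\<lambda>z. (norm (fst z - \<gamma> *\<^sub>R g (fst z) (snd z)))\<^sup>2)"
  proof (rule Bochner_Integration.integrable_bound)
    let ?B = "\<lambda>z. 2 * (norm (fst z))\<^sup>2 + 4 * \<gamma>\<^sup>2 * (norm (G (fst z)))\<^sup>2 + 4 * \<gamma>\<^sup>2 * (norm (N z))\<^sup>2"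
    show "integrable (\<nu> \<Otimes>\<^sub>M Q) ?B"
      using int_fst[OF G_int] int_fst[OF sq] N_int by simp
    have two: "(norm (u - v))\<^sup>2 \<le> 2 * (norm u)\<^sup>2 + 2 * (norm v)\<^sup>2" for u v :: 'a
    proof -
      have "(norm (u - v))\<^sup>2 \<le> (norm u + norm v)\<^sup>2"
        by (intro power_mono norm_triangle_ineq4) auto
      then show ?thesis
        using sum_squares_bound[of "norm u" "norm v"] by (simp add: power2_sum)
    qed
    have "(norm (fst z - \<gamma> *\<^sub>R g (fst z) (snd z)))\<^sup>2 \<le> ?B z" for z
    proof -
      have g_eq: "g (fst z) (snd z) = N z - (- G (fst z))" by (simp add: N_def)
      have "(norm (\<gamma> *\<^sub>R g (fst z) (snd z)))\<^sup>2 = \<gamma>\<^sup>2 * (norm (g (fst z) (snd z)))\<^sup>2"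
        by (simp add: power_mult_distrib)
      also have "\<dots> \<le> \<gamma>\<^sup>2 * (2 * (norm (N z))\<^sup>2 + 2 * (norm (G (fst z)))\<^sup>2)"
        unfolding g_eq using two[of "N z" "- G (fst z)"] by (intro mult_left_mono) auto
      finally show ?thesis
        using two[of "fst z" "\<gamma> *\<^sub>R g (fst z) (snd z)"] by (simp add: algebra_simps)
    qed
    then show "AE z in \<nu> \<Otimes>\<^sub>M Q. norm ((norm (fst z - \<gamma> *\<^sub>R g (fst z) (snd z)))\<^sup>2) \<le> norm (?B z)"
      by (auto intro!: always_eventually order_trans[OF _ abs_ge_self])
  qed measurable
  then show ?I by (simp add: case_prod_beta')
  have lhs_int: "integrable (\<nu> \<Otimes>\<^sub>M Q) (\<lambda>z. f (fst z - \<gamma> *\<^sub>R g (fst z) (snd z)))"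
    by (rule prob_space.integrable_smooth_bounded_below[OF pair.prob_space_axioms _ step_sq grad lip below]) measurable
  have pointwise: "f (fst z - \<gamma> *\<^sub>R g (fst z) (snd z))
      \<le> f (fst z) - (\<gamma> - \<gamma>\<^sup>2 * \<beta> / 2) * (norm (G (fst z)))\<^sup>2
        - (\<gamma> - \<gamma>\<^sup>2 * \<beta>) * inner (G (fst z)) (N z) + \<gamma>\<^sup>2 * \<beta> / 2 * (norm (N z))\<^sup>2" for z
  proof -
    have g_eq: "g (fst z) (snd z) = G (fst z) + N z" by (simp add: N_def)
    have "(norm (G (fst z) + N z))\<^sup>2
        = (norm (G (fst z)))\<^sup>2 + 2 * inner (G (fst z)) (N z) + (norm (N z))\<^sup>2"
      by (simp add: power2_norm_eq_inner inner_add inner_commute)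
    moreover have "inner (G (fst z)) (G (fst z)) = (norm (G (fst z)))\<^sup>2"
      by (simp add: power2_norm_eq_inner)
    ultimately show ?thesis
      using smooth_quadratic_upper_bound[OF grad lip, of "fst z" "- \<gamma> *\<^sub>R g (fst z) (snd z)"]
      unfolding g_eq
      by (simp add: inner_add_right power_mult_distrib) (simp add: algebra_simps add_divide_distrib)
  qed
  have "(\<integral>(y, w). f (y - \<gamma> *\<^sub>R g y w) \<partial>(\<nu> \<Otimes>\<^sub>M Q))
      = (\<integral>z. f (fst z - \<gamma> *\<^sub>R g (fst z) (snd z)) \<partial>(\<nu> \<Otimes>\<^sub>M Q))"
    by (simp add: case_prod_beta')
  also have "\<dots> \<le> (\<integral>z. f (fst z) - (\<gamma> - \<gamma>\<^sup>2 * \<beta> / 2) * (norm (G (fst z)))\<^sup>2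
        - (\<gamma> - \<gamma>\<^sup>2 * \<beta>) * inner (G (fst z)) (N z) + \<gamma>\<^sup>2 * \<beta> / 2 * (norm (N z))\<^sup>2 \<partial>(\<nu> \<Otimes>\<^sub>M Q))"
    using lhs_int int_fst[OF f_int] int_fst[OF G_int] GN_int N_int pointwise
    by (intro integral_mono) auto
  also have "\<dots> = (\<integral>y. f y \<partial>\<nu>) - (\<gamma> - \<gamma>\<^sup>2 * \<beta> / 2) * (\<integral>y. (norm (G y))\<^sup>2 \<partial>\<nu>)
        + \<gamma>\<^sup>2 * \<beta> / 2 * (\<integral>z. (norm (N z))\<^sup>2 \<partial>(\<nu> \<Otimes>\<^sub>M Q))"
    using int_fst[OF f_int] int_fst[OF G_int] GN_int N_int
    by (simp add: integral_fst[OF f_int] integral_fst[OF G_int] GN_zero)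
  also have "\<dots> \<le> (\<integral>y. f y \<partial>\<nu>) - (\<gamma> - \<gamma>\<^sup>2 * \<beta> / 2) * (\<integral>y. (norm (G y))\<^sup>2 \<partial>\<nu>) + \<gamma>\<^sup>2 * \<beta> / 2 * \<sigma>\<^sup>2"
    using N_le \<beta> by (intro add_left_mono mult_left_mono) auto
  finally show "(\<integral>(y, w). f (y - \<gamma> *\<^sub>R g y w) \<partial>(\<nu> \<Otimes>\<^sub>M Q))
      \<le> (\<integral>y. f y \<partial>\<nu>) - (\<gamma> - \<gamma>\<^sup>2 * \<beta> / 2) * (\<integral>y. (norm (G y))\<^sup>2 \<partial>\<nu>) + \<gamma>\<^sup>2 * \<beta> / 2 * \<sigma>\<^sup>2" .
qed

section \<open>Independence of an iterate and the next batch\<close>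

text \<open>
  The samples of round \<open>t\<close> inherit joint independence from the whole family, so their joint law is
  a product; currying away the constant index \<open>t\<close> moves it from \<open>{t} \<times> B\<close> to \<open>B\<close>. An empty batch
  is treated separately: then nothing makes \<open>P\<close> a probability measure, but both sides are the
  point mass at the empty function.
\<close>
lemma (in prob_space) distr_batch_of_indep:
  fixes W :: "'i \<Rightarrow> 'j \<Rightarrow> 'a \<Rightarrow> 'b"
  assumes indep: "indep_vars (\<lambda>_. S) (\<lambda>(t, i). W t i) (A \<times> B)"
    and law: "\<And>i. i \<in> B \<Longrightarrow> distr M S (W t i) = P" and t: "t \<in> A" and SP: "sets P = sets S"
  shows "distr M (PiM B (\<lambda>_. S)) (\<lambda>\<omega>. \<lambda>i\<in>B. W t i \<omega>) = PiM B (\<lambda>_. P)"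
proof (cases "B = {}")
  case True
  interpret D: prob_space "distr M (PiM {} (\<lambda>_. S)) (\<lambda>\<omega>. \<lambda>i\<in>{}. W t i \<omega>)"
    by (rule prob_space_distr) (intro measurable_restrict, simp)
  have D_one: "emeasure (distr M (PiM {} (\<lambda>_. S)) (\<lambda>\<omega>. \<lambda>i\<in>{}. W t i \<omega>)) {\<lambda>_. undefined} = 1"
    using D.emeasure_space_1 by (simp only: space_distr space_PiM PiE_empty_domain)
  show ?thesis
    unfolding True
  proof (rule measure_eqI_countable[where A = "{\<lambda>_. undefined}"])
    fix a :: "'j \<Rightarrow> 'b" assume "a \<in> {\<lambda>_. undefined}"
    then show "emeasure (distr M (PiM {} (\<lambda>_. S)) (\<lambda>\<omega>. \<lambda>i\<in>{}. W t i \<omega>)) {a}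
        = emeasure (PiM {} (\<lambda>_. P)) {a}"
      by (simp only: singleton_iff D_one) (simp add: PiM_empty)
  qed (auto simp: PiM_empty sets_PiM_empty)
next
  case False
  have rv: "random_variable S (case_prod W p)" if "p \<in> A \<times> B" for p
    using indep that by (auto simp: indep_vars_def split_beta)
  have rv_t: "W t i \<in> measurable M S" if "i \<in> B" for i
    using rv[of "(t, i)"] that t by simp
  have prob: "prob_space P" if "i \<in> B" for i
    using prob_space_distr[OF rv_t[OF that]] law[OF that] by simp
  let ?I = "{t} \<times> B"
  have sub: "indep_vars (\<lambda>_. S) (\<lambda>(t, i). W t i) ?I"
    by (rule indep_vars_subset[OF indep]) (use t in auto)
  have joint: "distr M (PiM ?I (\<lambda>_. S)) (\<lambda>\<omega>. \<lambda>p\<in>?I. case_prod W p \<omega>) = PiM ?I (\<lambda>_. P)"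
  proof -
    have "distr M (PiM ?I (\<lambda>_. S)) (\<lambda>\<omega>. \<lambda>p\<in>?I. case_prod W p \<omega>)
        = PiM ?I (\<lambda>p. distr M S (case_prod W p))"
      using sub rv t False by (subst indep_vars_iff_distr_eq_PiM'[symmetric]) auto
    also have "\<dots> = PiM ?I (\<lambda>_. P)"
      using law by (intro PiM_cong) auto
    finally show ?thesis .
  qed
  have joint_rv: "(\<lambda>\<omega>. \<lambda>p\<in>?I. case_prod W p \<omega>) \<in> measurable M (PiM ?I (\<lambda>_. S))"
    using rv t by (intro measurable_restrict) auto
  have select: "(\<lambda>f. \<lambda>i\<in>B. f (t, i)) \<in> measurable (PiM ?I (\<lambda>_. S)) (PiM B (\<lambda>_. S))"
    by (intro measurable_restrict measurable_component_singleton) auto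
  have "distr M (PiM B (\<lambda>_. S)) (\<lambda>\<omega>. \<lambda>i\<in>B. W t i \<omega>)
      = distr (distr M (PiM ?I (\<lambda>_. S)) (\<lambda>\<omega>. \<lambda>p\<in>?I. case_prod W p \<omega>))
          (PiM B (\<lambda>_. S)) (\<lambda>f. \<lambda>i\<in>B. f (t, i))"
    unfolding distr_distr[OF select joint_rv] by (intro distr_cong) auto
  also have "\<dots> = distr (PiM ?I (\<lambda>_. P)) (PiM B (\<lambda>_. P)) (\<lambda>f. \<lambda>i\<in>B. f (t, i))"
    unfolding joint using SP by (intro distr_cong sets_PiM_cong) auto
  also have "\<dots> = PiM B (\<lambda>_. P)"
    using prob by (intro distr_PiM_reindex[where M = "\<lambda>_. P"]) (auto simp: inj_on_def)
  finally show ?thesis .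
qed

text \<open>
  This is adaptedness in functional form: rather than a filtration, an explicit function of the
  samples with round index below \<open>t\<close>, which can be fed to the independence of disjoint subfamilies.
\<close>
lemma recursion_eq_function_of_past:
  fixes x :: "nat \<Rightarrow> 'o \<Rightarrow> 'a" and W :: "nat \<Rightarrow> 'i \<Rightarrow> 'o \<Rightarrow> 'b"
  assumes init: "\<And>\<omega>. \<omega> \<in> \<Omega> \<Longrightarrow> x 1 \<omega> = x1" "x1 \<in> space N"
    and succ: "\<And>t \<omega>. t \<in> {1..<T} \<Longrightarrow> \<omega> \<in> \<Omega> \<Longrightarrow> x (Suc t) \<omega> = \<Phi> t (x t \<omega>) (\<lambda>i\<in>B. W t i \<omega>)"
    and \<Phi>: "\<And>t. t \<in> {1..<T} \<Longrightarrow> (\<lambda>(y, w). \<Phi> t y w) \<in> measurable (N \<Otimes>\<^sub>M PiM B (\<lambda>_. S)) N"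
    and t: "1 \<le> t" "t \<le> T"
  shows "\<exists>h\<in>measurable (PiM ({1..<t} \<times> B) (\<lambda>_. S)) N.
    \<forall>\<omega>\<in>\<Omega>. x t \<omega> = h (\<lambda>p\<in>{1..<t} \<times> B. case_prod W p \<omega>)"
  using t
proof (induction t rule: dec_induct)
  case base
  show ?case
  proof (rule bexI)
    show "(\<lambda>_. x1) \<in> measurable (PiM ({1..<1} \<times> B) (\<lambda>_. S)) N"
      using init(2) by (rule measurable_const)
    show "\<forall>\<omega>\<in>\<Omega>. x 1 \<omega> = x1"
      using init(1) by blast
  qed
next
  case (step t)
  let ?A = "{1..<t} \<times> B" and ?A' = "{1..<Suc t} \<times> B"
  obtain h where h[measurable]: "h \<in> measurable (PiM ?A (\<lambda>_. S)) N"
    and x: "\<And>\<omega>. \<omega> \<in> \<Omega> \<Longrightarrow> x t \<omega> = h (\<lambda>p\<in>?A. case_prod W p \<omega>)"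
    using step.IH[OF Suc_leD[OF step.prems]] by blast
  have t: "t \<in> {1..<T}" using step.hyps step.prems by simp
  have past: "(\<lambda>f. restrict f ?A) \<in> measurable (PiM ?A' (\<lambda>_. S)) (PiM ?A (\<lambda>_. S))"
    by (rule measurable_restrict_subset) auto
  have batch: "(\<lambda>f. \<lambda>i\<in>B. f (t, i)) \<in> measurable (PiM ?A' (\<lambda>_. S)) (PiM B (\<lambda>_. S))"
    using step.hyps by (intro measurable_restrict measurable_component_singleton) auto
  have pair: "(\<lambda>f. (h (restrict f ?A), \<lambda>i\<in>B. f (t, i)))
      \<in> measurable (PiM ?A' (\<lambda>_. S)) (N \<Otimes>\<^sub>M PiM B (\<lambda>_. S))"
    using measurable_compose[OF past h] batch by (rule measurable_Pair)
  have "(\<lambda>f. \<Phi> t (h (restrict f ?A)) (\<lambda>i\<in>B. f (t, i))) \<in> measurable (PiM ?A' (\<lambda>_. S)) N"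
    using measurable_compose[OF pair \<Phi>[OF t]] by simp
  moreover have "x (Suc t) \<omega> = \<Phi> t (h (restrict (\<lambda>p\<in>?A'. case_prod W p \<omega>) ?A))
      (\<lambda>i\<in>B. (\<lambda>p\<in>?A'. case_prod W p \<omega>) (t, i))" if "\<omega> \<in> \<Omega>" for \<omega>
  proof -
    have "restrict (\<lambda>p\<in>?A'. case_prod W p \<omega>) ?A = (\<lambda>p\<in>?A. case_prod W p \<omega>)"
      by (auto simp: fun_eq_iff restrict_def)
    moreover have "(\<lambda>i\<in>B. (\<lambda>p\<in>?A'. case_prod W p \<omega>) (t, i)) = (\<lambda>i\<in>B. W t i \<omega>)"
      using step.hyps by (auto simp: fun_eq_iff restrict_def)
    ultimately show ?thesis
      using succ[OF t that] x[OF that] by simp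
  qed
  ultimately show ?case
    by (intro bexI[where x = "\<lambda>f. \<Phi> t (h (restrict f ?A)) (\<lambda>i\<in>B. f (t, i))"] ballI)
qed

text \<open>
  The sample indices of rounds before \<open>t\<close> and of round \<open>t\<close> are disjoint, so the two subfamilies are
  independent and have a product law. Both the iterate and the batch are measurable images of
  their subfamily, and a product of maps sends a product measure to a product measure.
\<close>
lemma (in prob_space) recursion_joint_law_with_next_batch:
  fixes x :: "nat \<Rightarrow> 'a \<Rightarrow> 'c" and W :: "nat \<Rightarrow> 'i \<Rightarrow> 'a \<Rightarrow> 'b"
  assumes indep: "indep_vars (\<lambda>_. S) (\<lambda>(t, i). W t i) ({1..T} \<times> B)"
    and law: "\<And>t i. t \<in> {1..T} \<Longrightarrow> i \<in> B \<Longrightarrow> distr M S (W t i) = P t"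
    and SP: "\<And>t. t \<in> {1..T} \<Longrightarrow> sets (P t) = sets S"
    and init: "\<And>\<omega>. \<omega> \<in> space M \<Longrightarrow> x 1 \<omega> = x1" "x1 \<in> space N"
    and step: "\<And>t \<omega>. t \<in> {1..<T} \<Longrightarrow> \<omega> \<in> space M \<Longrightarrow>
      x (Suc t) \<omega> = \<Phi> t (x t \<omega>) (\<lambda>i\<in>B. W t i \<omega>)"
    and \<Phi>: "\<And>t. t \<in> {1..<T} \<Longrightarrow> (\<lambda>(y, w). \<Phi> t y w) \<in> measurable (N \<Otimes>\<^sub>M PiM B (\<lambda>_. S)) N"
    and t: "t \<in> {1..T}"
  shows "x t \<in> measurable M N"
    and "(\<lambda>\<omega>. \<lambda>i\<in>B. W t i \<omega>) \<in> measurable M (PiM B (\<lambda>_. S))"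
    and "distr M (N \<Otimes>\<^sub>M PiM B (\<lambda>_. S)) (\<lambda>\<omega>. (x t \<omega>, \<lambda>i\<in>B. W t i \<omega>))
      = distr M N (x t) \<Otimes>\<^sub>M PiM B (\<lambda>_. P t)"
proof -
  let ?A = "{1..<t} \<times> B" and ?C = "{t} \<times> B"
  let ?past = "\<lambda>\<omega>. \<lambda>p\<in>?A. case_prod W p \<omega>" and ?next = "\<lambda>\<omega>. \<lambda>p\<in>?C. case_prod W p \<omega>"
  let ?batch = "\<lambda>\<omega>. \<lambda>i\<in>B. W t i \<omega>" and ?select = "\<lambda>f. \<lambda>i\<in>B. f (t, i)"
  obtain h where h: "h \<in> measurable (PiM ?A (\<lambda>_. S)) N"
    and x: "\<And>\<omega>. \<omega> \<in> space M \<Longrightarrow> x t \<omega> = h (?past \<omega>)"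
    using recursion_eq_function_of_past[of "space M" x x1 N T \<Phi> W B S t]
      init step \<Phi> t by auto
  have select: "?select \<in> measurable (PiM ?C (\<lambda>_. S)) (PiM B (\<lambda>_. S))"
    by (intro measurable_restrict measurable_component_singleton) auto
  have "indep_var (PiM ?A (\<lambda>_. S)) ?past (PiM ?C (\<lambda>_. S)) ?next"
    using t by (intro indep_var_restrict[OF indep]) auto
  then have past: "?past \<in> measurable M (PiM ?A (\<lambda>_. S))"
    and next_vars: "?next \<in> measurable M (PiM ?C (\<lambda>_. S))"
    and prod: "distr M (PiM ?A (\<lambda>_. S)) ?past \<Otimes>\<^sub>M distr M (PiM ?C (\<lambda>_. S)) ?next
      = distr M (PiM ?A (\<lambda>_. S) \<Otimes>\<^sub>M PiM ?C (\<lambda>_. S)) (\<lambda>\<omega>. (?past \<omega>, ?next \<omega>))"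
    by (simp_all add: indep_var_distribution_eq)
  have batch: "?batch = (\<lambda>\<omega>. ?select (?next \<omega>))"
    by (simp add: fun_eq_iff)
  have h_past: "(\<lambda>\<omega>. h (?past \<omega>)) \<in> measurable M N"
    by (rule measurable_compose[OF past h])
  show "x t \<in> measurable M N"
    using measurable_cong[of M "x t" "\<lambda>\<omega>. h (?past \<omega>)" N] x h_past by blast
  show batch_meas: "?batch \<in> measurable M (PiM B (\<lambda>_. S))"
    unfolding batch by (rule measurable_compose[OF next_vars select])
  have law_h: "distr (distr M (PiM ?A (\<lambda>_. S)) ?past) N h = distr M N (x t)"
    unfolding distr_distr[OF h past] using x by (intro distr_cong) auto
  have law_batch: "distr (distr M (PiM ?C (\<lambda>_. S)) ?next) (PiM B (\<lambda>_. S)) ?select = PiM B (\<lambda>_. P t)"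
  proof -
    have "distr (distr M (PiM ?C (\<lambda>_. S)) ?next) (PiM B (\<lambda>_. S)) ?select
        = distr M (PiM B (\<lambda>_. S)) ?batch"
      unfolding distr_distr[OF select next_vars] by (intro distr_cong) auto
    also have "\<dots> = PiM B (\<lambda>_. P t)"
      by (rule distr_batch_of_indep[OF indep]) (use law SP t in auto)
    finally show ?thesis .
  qed
  have "prob_space (PiM B (\<lambda>_. P t))"
    unfolding law_batch[symmetric] distr_distr[OF select next_vars]
    by (intro prob_space_distr measurable_comp[OF next_vars select])
  then have sigma: "sigma_finite_measure (distr (distr M (PiM ?C (\<lambda>_. S)) ?next) (PiM B (\<lambda>_. S)) ?select)"
    unfolding law_batch by (rule prob_space_imp_sigma_finite)
  have both: "(\<lambda>(a, c). (h a, ?select c))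
      \<in> measurable (PiM ?A (\<lambda>_. S) \<Otimes>\<^sub>M PiM ?C (\<lambda>_. S)) (N \<Otimes>\<^sub>M PiM B (\<lambda>_. S))"
    unfolding case_prod_beta'
    by (intro measurable_Pair measurable_compose[OF measurable_fst h] measurable_compose[OF measurable_snd select])
  have "distr M N (x t) \<Otimes>\<^sub>M PiM B (\<lambda>_. P t)
      = distr (distr M (PiM ?A (\<lambda>_. S)) ?past \<Otimes>\<^sub>M distr M (PiM ?C (\<lambda>_. S)) ?next)
          (N \<Otimes>\<^sub>M PiM B (\<lambda>_. S)) (\<lambda>(a, c). (h a, ?select c))"
    unfolding law_h[symmetric] law_batch[symmetric]
    by (rule pair_measure_distr) (use h select sigma in auto)
  also have "\<dots> = distr M (N \<Otimes>\<^sub>M PiM B (\<lambda>_. S)) (\<lambda>\<omega>. (x t \<omega>, ?batch \<omega>))"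
    unfolding prod distr_distr[OF both measurable_Pair[OF past next_vars]]
    using x by (intro distr_cong) auto
  finally show "distr M (N \<Otimes>\<^sub>M PiM B (\<lambda>_. S)) (\<lambda>\<omega>. (x t \<omega>, ?batch \<omega>))
      = distr M N (x t) \<Otimes>\<^sub>M PiM B (\<lambda>_. P t)" by (rule sym)
qed

section \<open>Summing the recursion\<close>

text \<open>
  The left-hand side proved by induction carries the extra term \<open>(1 - a) * D n\<close>: it is exactly what
  the recursion consumes when \<open>n\<close> increases, and at the end it is nonnegative and can be dropped.
\<close>
lemma sum_le_of_contraction:
  fixes D e :: "nat \<Rightarrow> real"
  assumes rec: "\<And>t. t \<in> {1..<T} \<Longrightarrow> D (Suc t) \<le> (1 - a) * D t + e t"
    and nonneg: "0 \<le> D T" and a: "a \<le> 1" and T: "1 \<le> T"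
  shows "a * (\<Sum>t=1..T. D t) \<le> D 1 + (\<Sum>t=1..T-1. e t)"
proof -
  have "a * (\<Sum>t=1..n. D t) + (1 - a) * D n \<le> D 1 + (\<Sum>t=1..n-1. e t)" if "1 \<le> n" "n \<le> T" for n
    using that
  proof (induction n rule: dec_induct)
    case base
    then show ?case by (simp add: algebra_simps)
  next
    case (step n)
    have "(\<Sum>t=1..Suc n - 1. e t) = (\<Sum>t=1..n-1. e t) + e n"
      using step by (cases n) auto
    then show ?case
      using step rec[of n] by (simp add: algebra_simps)
  qed
  from this[OF T] nonneg a show ?thesis
    using mult_nonneg_nonneg[of "1 - a" "D T"] by linarith
qed

section \<open>The regret bound\<close>

theorem theorem1:
  fixes T m :: nat
    and L :: "real ^ 'nx \<Rightarrow> real ^ 'nw \<Rightarrow> real"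
    and P :: "nat \<Rightarrow> (real ^ 'nw) measure"
    and F :: "nat \<Rightarrow> real ^ 'nx \<Rightarrow> real"
    and Fstar :: "nat \<Rightarrow> real"
    and M :: "'o measure"
    and W :: "nat \<Rightarrow> nat \<Rightarrow> 'o \<Rightarrow> real ^ 'nw"
    and g :: "nat \<Rightarrow> real ^ 'nx \<Rightarrow> (nat \<Rightarrow> real ^ 'nw) \<Rightarrow> real ^ 'nx"
    and x :: "nat \<Rightarrow> 'o \<Rightarrow> real ^ 'nx"
    and x1 :: "real ^ 'nx"
    and X :: "(real ^ 'nx) set"
    and Kw :: "real ^ 'nx \<Rightarrow> real"
    and J :: "real \<Rightarrow> real"
    and \<sigma> \<eta> :: "nat \<Rightarrow> real"
    and \<beta> \<mu> \<gamma> \<zeta> K :: real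
  assumes T: "T \<ge> 1"
    and P: "\<And>t. t \<in> {1..T} \<Longrightarrow> prob_space (P t) \<and> sets (P t) = sets borel"
    and F: "\<And>t y. t \<in> {1..T} \<Longrightarrow> F t y = (\<integral>w. L y w \<partial>P t)"
    and Fstar: "\<And>t. t \<in> {1..T} \<Longrightarrow> Fstar t \<in> range (F t) \<and> (\<forall>y. Fstar t \<le> F t y)"
    and F_C1: "\<And>t. t \<in> {1..T} \<Longrightarrow>
        (\<forall>y. F t differentiable (at y)) \<and> continuous_on UNIV (grad (F t))"
    and L_diff: "\<And>t y. t \<in> {1..T} \<Longrightarrow> AE w in P t. (\<lambda>z. L z w) differentiable (at y)"
    and M: "prob_space M"
    and W_indep: "prob_space.indep_vars M (\<lambda>_. borel) (\<lambda>(t, i). W t i) ({1..T} \<times> {1..m})"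
    and W_distr: "\<And>t i. t \<in> {1..T} \<Longrightarrow> i \<in> {1..m} \<Longrightarrow> distr M borel (W t i) = P t"
    and g_meas: "\<And>t. t \<in> {1..T} \<Longrightarrow>
        (\<lambda>(y, w). g t y w) \<in> borel_measurable (borel \<Otimes>\<^sub>M PiM {1..m} (\<lambda>_. borel))"
    and x_init: "\<And>\<omega>. \<omega> \<in> space M \<Longrightarrow> x 1 \<omega> = x1"
    and x_step: "\<And>t \<omega>. t \<in> {1..<T} \<Longrightarrow> \<omega> \<in> space M \<Longrightarrow>
        x (Suc t) \<omega> = x t \<omega> - \<gamma> *\<^sub>R g t (x t \<omega>) (\<lambda>i\<in>{1..m}. W t i \<omega>)"
    and L_meas: "\<And>y. L y \<in> borel_measurable borel"
    and F_finite: "\<And>t y. t \<in> {1..T} \<Longrightarrow> integrable (P t) (L y)"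
    and L_loc_Lipschitz: "\<And>t y. t \<in> {1..T} \<Longrightarrow>
        \<exists>C. C \<in> borel_measurable borel \<and> (\<forall>w. C w > 0) \<and> integrable (P t) C \<and>
          (\<exists>U. open U \<and> y \<in> U \<and>
            (\<forall>y1\<in>U. \<forall>y2\<in>U. AE w in P t. w \<in> msupport (P t) \<longrightarrow>
              \<bar>L y1 w - L y2 w\<bar> \<le> C w * norm (y1 - y2)))"
    and L_diff_supp: "\<And>t y. t \<in> {1..T} \<Longrightarrow>
        AE w in P t. w \<in> msupport (P t) \<longrightarrow> (\<lambda>z. L z w) differentiable (at y)"
    and supp_bounded: "\<And>t. t \<in> {1..T} \<Longrightarrow> bounded (msupport (P t))"
    and \<sigma>_pos: "\<And>t. t \<in> {1..T} \<Longrightarrow> \<sigma> t > 0"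
    and g_unbiased: "\<And>t y. t \<in> {1..T} \<Longrightarrow>
        has_bochner_integral (PiM {1..m} (\<lambda>_. P t)) (g t y) (grad (F t) y)"
    and g_variance: "\<And>t. t \<in> {1..T} \<Longrightarrow>
        AE \<omega> in M. (\<integral>\<^sup>+ w. ennreal ((norm (g t (x t \<omega>) w - grad (F t) (x t \<omega>)))\<^sup>2)
          \<partial>PiM {1..m} (\<lambda>_. P t)) \<le> ennreal ((\<sigma> t)\<^sup>2)"
    and \<eta>_pos: "\<And>t. t \<in> {1..<T} \<Longrightarrow> \<eta> t > 0"
    and P_shift: "\<And>t. t \<in> {1..<T} \<Longrightarrow> wasserstein1 (P (Suc t)) (P t) \<le> ennreal (\<eta> t)"
    and \<beta>_pos: "\<beta> > 0"
    and F_smooth: "\<And>t y z. t \<in> {1..T} \<Longrightarrow>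
        norm (grad (F t) z - grad (F t) y) \<le> \<beta> * norm (z - y)"
    and \<mu>_pos: "\<mu> > 0"
    and F_PL: "\<And>t y. t \<in> {1..T} \<Longrightarrow> y \<in> X \<Longrightarrow>
        (1/2) * (norm (grad (F t) y))\<^sup>2 \<ge> \<mu> * (F t y - Fstar t)"
    and x_in_X: "\<And>t. t \<in> {1..T} \<Longrightarrow> AE \<omega> in M. x t \<omega> \<in> X"
    and L_Lipschitz_w: "\<And>y w w'. \<bar>L y w - L y w'\<bar> \<le> Kw y * norm (w - w')"
    and K_max: "K \<in> range Kw" "\<And>y. Kw y \<le> K"
    and J_incr: "mono_on {0..} J" "\<And>u. u \<ge> 0 \<Longrightarrow> J u \<ge> 0"
    and grad_shift: "\<And>t y. t \<in> {1..<T} \<Longrightarrow>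
        norm ((\<integral>w. grad (\<lambda>z. L z w) y \<partial>completion (P (Suc t)))
            - (\<integral>w. grad (\<lambda>z. L z w) y \<partial>completion (P t))) \<le> J (\<eta> t)"
    and \<gamma>_range: "\<gamma> \<in> {0<..<min (1 / \<beta>) (1 / (2 * \<mu>))}"
    and \<zeta>: "\<zeta> = - (\<gamma>\<^sup>2 * \<beta> / 2) + \<gamma>"
  shows "(\<forall>t\<in>{1..T}. integrable M (\<lambda>\<omega>. F t (x t \<omega>) - Fstar t)) \<and>
    dynamic_regret M F Fstar x T \<le>
      1 / (2 * \<mu> * \<zeta>) * (F 1 x1 - Fstar 1)
      + K / (\<mu> * \<zeta>) * (\<Sum>t=1..T-1. \<eta> t)
      + 1 / (4 * \<mu>\<^sup>2 * \<zeta>) * (\<Sum>t=1..T-1. (J (\<eta> t))\<^sup>2)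
      + \<gamma> * \<beta> / (2 * \<mu>) * (\<Sum>t=1..T-1. (\<sigma> t)\<^sup>2)"
proof -
  interpret M: prob_space M by fact
  have grad_F: "GDERIV (F t) y :> grad (F t) y" if "t \<in> {1..T}" for t y
    using F_C1[OF that] by (intro GDERIV_grad) auto
  have Fstar_le: "Fstar t \<le> F t y" if "t \<in> {1..T}" for t y
    using Fstar[OF that] by auto

  \<comment> \<open>Testing the Lipschitz bound on two points at distance one shows \<open>Kw 0 \<ge> 0\<close>.\<close>
  have K_nonneg: "0 \<le> K"
  proof -
    have "0 \<le> \<bar>L 0 (axis undefined 1) - L 0 0\<bar>" by simp
    also have "\<dots> \<le> Kw 0 * norm (axis undefined 1 - 0 :: real ^ 'nw)" by (rule L_Lipschitz_w)
    also have "\<dots> = Kw 0" by simp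
    finally show ?thesis using K_max(2)[of 0] by simp
  qed
  have drift: "\<bar>F (Suc t) y - F t y\<bar> \<le> K * \<eta> t" if t: "t \<in> {1..<T}" for t y
  proof -
    have t': "t \<in> {1..T}" "Suc t \<in> {1..T}" using t by auto
    have lip: "\<bar>L y w - L y w'\<bar> \<le> K * norm (w - w')" for w w'
      using L_Lipschitz_w[of y w w'] mult_right_mono[OF K_max(2)[of y], of "norm (w - w')"] by simp
    show ?thesis
      unfolding F[OF t'(1)] F[OF t'(2)]
      by (rule integral_diff_le_wasserstein1[OF _ _ _ _ lip K_nonneg P_shift[OF t]])
        (use P t' F_finite \<eta>_pos[OF t] in auto)
  qed
  \<comment> \<open>Compare at a minimiser of the new objective.\<close>
  have drift_min: "Fstar t \<le> Fstar (Suc t) + K * \<eta> t" if t: "t \<in> {1..<T}" for t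
  proof -
    have t': "t \<in> {1..T}" "Suc t \<in> {1..T}" using t by auto
    obtain y where "Fstar (Suc t) = F (Suc t) y" using Fstar[OF t'(2)] by auto
    then show ?thesis using Fstar_le[OF t'(1), of y] drift[OF t, of y] by linarith
  qed

  let ?S = "PiM {1..m} (\<lambda>_. borel :: (real ^ 'nw) measure)"
  let ?Q = "\<lambda>t. PiM {1..m} (\<lambda>_. P t)"
  let ?batch = "\<lambda>t \<omega>. \<lambda>i\<in>{1..m}. W t i \<omega>"
  have \<Phi>: "(\<lambda>(y, w). y - \<gamma> *\<^sub>R g t y w) \<in> measurable (borel \<Otimes>\<^sub>M ?S) borel" if "t \<in> {1..T}" for t
  proof -
    have [measurable]: "(\<lambda>z. g t (fst z) (snd z)) \<in> borel_measurable (borel \<Otimes>\<^sub>M ?S)"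
      using g_meas[OF that] by (simp add: case_prod_beta')
    show ?thesis unfolding case_prod_beta' by measurable
  qed
  have x_meas: "x t \<in> borel_measurable M"
    and batch_meas: "?batch t \<in> measurable M ?S"
    and joint: "distr M (borel \<Otimes>\<^sub>M ?S) (\<lambda>\<omega>. (x t \<omega>, ?batch t \<omega>)) = distr M borel (x t) \<Otimes>\<^sub>M ?Q t"
    if t: "t \<in> {1..T}" for t
    using M.recursion_joint_law_with_next_batch[where \<Phi> = "\<lambda>t y w. y - \<gamma> *\<^sub>R g t y w",
        OF W_indep W_distr _ x_init _ x_step \<Phi> t] P by auto
  have sets_pair: "sets (distr M borel (x t) \<Otimes>\<^sub>M ?Q t) = sets (borel \<Otimes>\<^sub>M ?S)" if "t \<in> {1..T}" for t
    using P[OF that] by (intro sets_pair_measure_cong sets_PiM_cong) auto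

  \<comment> \<open>\<open>stochastic_gradient_step\<close>, carried over from the product law to the sample space \<open>M\<close>\<close>
  have step_law: "integrable M (\<lambda>\<omega>. (norm (x t \<omega> - \<gamma> *\<^sub>R g t (x t \<omega>) (?batch t \<omega>)))\<^sup>2)"
    "(\<integral>\<omega>. F t (x t \<omega> - \<gamma> *\<^sub>R g t (x t \<omega>) (?batch t \<omega>)) \<partial>M)
      \<le> (\<integral>\<omega>. F t (x t \<omega>) \<partial>M) - \<zeta> * (\<integral>\<omega>. (norm (grad (F t) (x t \<omega>)))\<^sup>2 \<partial>M) + \<gamma>\<^sup>2 * \<beta> / 2 * (\<sigma> t)\<^sup>2"
    if t: "t \<in> {1..T}" and sq: "integrable M (\<lambda>\<omega>. (norm (x t \<omega>))\<^sup>2)" for t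
  proof -
    note [measurable] = x_meas[OF t]
    have pair_meas: "(\<lambda>\<omega>. (x t \<omega>, ?batch t \<omega>)) \<in> measurable M (borel \<Otimes>\<^sub>M ?S)"
      using x_meas[OF t] batch_meas[OF t] by (rule measurable_Pair)
    have F_meas[measurable]: "F t \<in> borel_measurable borel"
      using GDERIV_imp_continuous_on[OF grad_F[OF t]] by (rule borel_measurable_continuous_onI)
    have G_meas[measurable]: "grad (F t) \<in> borel_measurable borel"
      using F_C1[OF t] by (auto intro: borel_measurable_continuous_onI)
    have Q: "prob_space (?Q t)" using P[OF t] by (intro prob_space_PiM) auto
    interpret Q: prob_space "?Q t" by (rule Q)
    have g: "(\<lambda>(y, w). g t y w) \<in> borel_measurable (distr M borel (x t) \<Otimes>\<^sub>M ?Q t)"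
      using g_meas[OF t] measurable_cong_sets[OF sets_pair[OF t] refl] by blast
    \<comment> \<open>Needed to pass from almost every \<open>\<omega>\<close> to almost every value of \<open>x t\<close>.\<close>
    have noise_meas: "(\<lambda>y. \<integral>\<^sup>+ w. ennreal ((norm (g t y w - grad (F t) y))\<^sup>2) \<partial>?Q t)
        \<in> borel_measurable borel"
    proof -
      have sets_eq: "sets (borel \<Otimes>\<^sub>M ?Q t) = sets (borel \<Otimes>\<^sub>M ?S)"
        using P[OF t] by (intro sets_pair_measure_cong sets_PiM_cong) auto
      have [measurable]: "(\<lambda>z. g t (fst z) (snd z)) \<in> borel_measurable (borel \<Otimes>\<^sub>M ?Q t)"
        using g_meas[OF t] unfolding measurable_cong_sets[OF sets_eq refl] case_prod_beta' .
      have "(\<lambda>z. ennreal ((norm (g t (fst z) (snd z) - grad (F t) (fst z)))\<^sup>2))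
          \<in> borel_measurable (borel \<Otimes>\<^sub>M ?Q t)" by measurable
      from Q.borel_measurable_nn_integral_fst[OF this] show ?thesis by simp
    qed
    have var: "AE y in distr M borel (x t).
        (\<integral>\<^sup>+ w. ennreal ((norm (g t y w - grad (F t) y))\<^sup>2) \<partial>?Q t) \<le> ennreal ((\<sigma> t)\<^sup>2)"
      using g_variance[OF t] noise_meas by (subst AE_distr_iff) auto
    have sq': "integrable (distr M borel (x t)) (\<lambda>y. (norm y)\<^sup>2)"
      using sq by (subst integrable_distr_eq) auto
    note step = stochastic_gradient_step[OF M.prob_space_distr[OF x_meas[OF t]] sets_distr Q g
        grad_F[OF t] F_smooth[OF t] less_imp_le[OF \<beta>_pos] Fstar_le[OF t] g_unbiased[OF t] var sq',
        of \<gamma>]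
    have norm_meas: "(\<lambda>(y, w). (norm (y - \<gamma> *\<^sub>R g t y w))\<^sup>2) \<in> borel_measurable (borel \<Otimes>\<^sub>M ?S)"
      using measurable_compose[OF \<Phi>[OF t], of "\<lambda>z. (norm z)\<^sup>2" borel] by (simp add: case_prod_beta')
    have F_step_meas: "(\<lambda>(y, w). F t (y - \<gamma> *\<^sub>R g t y w)) \<in> borel_measurable (borel \<Otimes>\<^sub>M ?S)"
      using measurable_compose[OF \<Phi>[OF t] F_meas] by (simp add: case_prod_beta')
    show "integrable M (\<lambda>\<omega>. (norm (x t \<omega> - \<gamma> *\<^sub>R g t (x t \<omega>) (?batch t \<omega>)))\<^sup>2)"
      using step(1) unfolding joint[OF t, symmetric] integrable_distr_eq[OF pair_meas norm_meas]
      by simp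
    show "(\<integral>\<omega>. F t (x t \<omega> - \<gamma> *\<^sub>R g t (x t \<omega>) (?batch t \<omega>)) \<partial>M)
      \<le> (\<integral>\<omega>. F t (x t \<omega>) \<partial>M) - \<zeta> * (\<integral>\<omega>. (norm (grad (F t) (x t \<omega>)))\<^sup>2 \<partial>M) + \<gamma>\<^sup>2 * \<beta> / 2 * (\<sigma> t)\<^sup>2"
      using step(2) unfolding joint[OF t, symmetric] integral_distr[OF pair_meas F_step_meas]
      by (simp add: \<zeta> integral_distr algebra_simps)
  qed

  have sq: "integrable M (\<lambda>\<omega>. (norm (x t \<omega>))\<^sup>2)" if "1 \<le> t" "t \<le> T" for t
    using that
  proof (induction t rule: dec_induct)
    case base
    have "integrable M (\<lambda>\<omega>. (norm (x 1 \<omega>))\<^sup>2) \<longleftrightarrow> integrable M (\<lambda>\<omega>. (norm x1)\<^sup>2)"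
      by (rule Bochner_Integration.integrable_cong) (auto simp: x_init[unfolded One_nat_def])
    then show ?case by simp
  next
    case (step t)
    have t: "t \<in> {1..T}" "t \<in> {1..<T}" using step by auto
    have "integrable M (\<lambda>\<omega>. (norm (x (Suc t) \<omega>))\<^sup>2)
        \<longleftrightarrow> integrable M (\<lambda>\<omega>. (norm (x t \<omega> - \<gamma> *\<^sub>R g t (x t \<omega>) (?batch t \<omega>)))\<^sup>2)"
      by (rule Bochner_Integration.integrable_cong) (auto simp: x_step[OF t(2)])
    then show ?case using step_law(1)[OF t(1)] step by simp
  qed
  have F_int: "integrable M (\<lambda>\<omega>. F s (x t \<omega>))" if "s \<in> {1..T}" "t \<in> {1..T}" for s t
    by (rule M.integrable_smooth_bounded_below[OF x_meas sq grad_F F_smooth Fstar_le])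
      (use that in auto)
  define D where "D t = (\<integral>\<omega>. F t (x t \<omega>) - Fstar t \<partial>M)" for t
  have D_eq: "D t = (\<integral>\<omega>. F t (x t \<omega>) \<partial>M) - Fstar t" if "t \<in> {1..T}" for t
    unfolding D_def using F_int[OF that that] by (simp add: M.prob_space)
  have D_nonneg: "0 \<le> D t" if "t \<in> {1..T}" for t
    unfolding D_def using Fstar_le[OF that] by (intro integral_nonneg_AE) auto

  have \<gamma>: "0 < \<gamma>" "\<gamma> * \<beta> < 1" "2 * \<mu> * \<gamma> < 1"
    using \<gamma>_range \<beta>_pos \<mu>_pos by (auto simp: field_simps)
  \<comment> \<open>\<open>\<gamma> * \<beta> < 1\<close> bounds \<open>\<zeta>\<close> from below, and \<open>2 * \<mu> * \<gamma> < 1\<close> makes the contraction factor nonnegative.\<close>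
  have \<zeta>_ge: "\<gamma> \<le> 2 * \<zeta>"
    using mult_left_mono[of "\<gamma> * \<beta>" 1 \<gamma>] \<gamma> by (simp add: \<zeta> power2_eq_square algebra_simps)
  have \<zeta>_pos: "0 < \<zeta>" using \<zeta>_ge \<gamma>(1) by linarith
  have \<zeta>_le: "\<zeta> \<le> \<gamma>" using \<beta>_pos by (simp add: \<zeta>)
  have contraction: "2 * \<mu> * \<zeta> \<le> 1"
    using mult_left_mono[OF \<zeta>_le, of "2 * \<mu>"] \<mu>_pos \<gamma>(3) by linarith

  have recursion: "D (Suc t) \<le> (1 - 2 * \<mu> * \<zeta>) * D t + (2 * K * \<eta> t + \<gamma>\<^sup>2 * \<beta> / 2 * (\<sigma> t)\<^sup>2)"
    if t: "t \<in> {1..<T}" for t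
  proof -
    have t': "t \<in> {1..T}" "Suc t \<in> {1..T}" "1 \<le> t" "t \<le> T" using t by auto
    have "(\<integral>\<omega>. F (Suc t) (x (Suc t) \<omega>) \<partial>M) \<le> (\<integral>\<omega>. F t (x (Suc t) \<omega>) + K * \<eta> t \<partial>M)"
    proof (rule integral_mono)
      show "F (Suc t) (x (Suc t) \<omega>) \<le> F t (x (Suc t) \<omega>) + K * \<eta> t" for \<omega>
        using drift[OF t, of "x (Suc t) \<omega>"] by linarith
    qed (use F_int t' in auto)
    also have "\<dots> = (\<integral>\<omega>. F t (x (Suc t) \<omega>) \<partial>M) + K * \<eta> t"
      using F_int[OF t'(1,2)] by (simp add: M.prob_space)
    also have "(\<integral>\<omega>. F t (x (Suc t) \<omega>) \<partial>M)
        = (\<integral>\<omega>. F t (x t \<omega> - \<gamma> *\<^sub>R g t (x t \<omega>) (?batch t \<omega>)) \<partial>M)"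
      by (rule Bochner_Integration.integral_cong) (auto simp: x_step[OF t])
    also have "\<dots> \<le> (\<integral>\<omega>. F t (x t \<omega>) \<partial>M) - \<zeta> * (\<integral>\<omega>. (norm (grad (F t) (x t \<omega>)))\<^sup>2 \<partial>M)
        + \<gamma>\<^sup>2 * \<beta> / 2 * (\<sigma> t)\<^sup>2"
      by (rule step_law(2)[OF t'(1) sq[OF t'(3,4)]])
    finally have descent: "(\<integral>\<omega>. F (Suc t) (x (Suc t) \<omega>) \<partial>M)
        \<le> (\<integral>\<omega>. F t (x t \<omega>) \<partial>M) - \<zeta> * (\<integral>\<omega>. (norm (grad (F t) (x t \<omega>)))\<^sup>2 \<partial>M)
          + \<gamma>\<^sup>2 * \<beta> / 2 * (\<sigma> t)\<^sup>2 + K * \<eta> t" by simp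
    have "2 * \<mu> * D t = (\<integral>\<omega>. 2 * \<mu> * (F t (x t \<omega>) - Fstar t) \<partial>M)"
      by (simp add: D_def)
    also have "\<dots> \<le> (\<integral>\<omega>. (norm (grad (F t) (x t \<omega>)))\<^sup>2 \<partial>M)"
    proof (rule integral_mono_AE)
      show "AE \<omega> in M. 2 * \<mu> * (F t (x t \<omega>) - Fstar t) \<le> (norm (grad (F t) (x t \<omega>)))\<^sup>2"
        using x_in_X[OF t'(1)]
      proof eventually_elim
        case (elim \<omega>)
        then show ?case using F_PL[OF t'(1) elim] by simp
      qed
      show "integrable M (\<lambda>\<omega>. (norm (grad (F t) (x t \<omega>)))\<^sup>2)"
        by (rule M.integrable_norm_square_Lipschitz[OF x_meas[OF t'(1)] sq[OF t'(3,4)] F_smooth[OF t'(1)]])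
    qed (use F_int[OF t'(1,1)] in simp)
    finally have "\<zeta> * (2 * \<mu> * D t) \<le> \<zeta> * (\<integral>\<omega>. (norm (grad (F t) (x t \<omega>)))\<^sup>2 \<partial>M)"
      using \<zeta>_pos by (intro mult_left_mono) auto
    moreover have "(1 - 2 * \<mu> * \<zeta>) * D t = D t - \<zeta> * (2 * \<mu> * D t)" by (simp add: algebra_simps)
    ultimately show ?thesis
      using descent drift_min[OF t] D_eq[OF t'(1)] D_eq[OF t'(2)] by linarith
  qed

  have D1: "D 1 = F 1 x1 - Fstar 1"
  proof -
    have "D 1 = (\<integral>\<omega>. F 1 x1 - Fstar 1 \<partial>M)"
      unfolding D_def by (rule Bochner_Integration.integral_cong) (auto simp: x_init[unfolded One_nat_def])
    then show ?thesis by (simp add: M.prob_space)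
  qed
  have "2 * \<mu> * \<zeta> * (\<Sum>t=1..T. D t)
      \<le> D 1 + (\<Sum>t=1..T-1. 2 * K * \<eta> t + \<gamma>\<^sup>2 * \<beta> / 2 * (\<sigma> t)\<^sup>2)"
    using T by (intro sum_le_of_contraction recursion D_nonneg contraction) auto
  also have "\<dots> = (F 1 x1 - Fstar 1) + 2 * K * (\<Sum>t=1..T-1. \<eta> t) + \<gamma>\<^sup>2 * \<beta> / 2 * (\<Sum>t=1..T-1. (\<sigma> t)\<^sup>2)"
    unfolding D1 by (simp add: sum.distrib sum_distrib_left)
  also have "\<dots> \<le> (F 1 x1 - Fstar 1) + 2 * K * (\<Sum>t=1..T-1. \<eta> t)
      + \<gamma> * \<beta> * \<zeta> * (\<Sum>t=1..T-1. (\<sigma> t)\<^sup>2)"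
  proof -
    have "\<gamma>\<^sup>2 * \<beta> / 2 \<le> \<gamma> * \<beta> * \<zeta>"
      using mult_left_mono[OF \<zeta>_ge, of "\<gamma> * \<beta>"] \<gamma>(1) \<beta>_pos by (simp add: power2_eq_square algebra_simps)
    then show ?thesis by (intro add_left_mono mult_right_mono sum_nonneg) auto
  qed
  also have "\<dots> = 2 * \<mu> * \<zeta> * (1 / (2 * \<mu> * \<zeta>) * (F 1 x1 - Fstar 1)
      + K / (\<mu> * \<zeta>) * (\<Sum>t=1..T-1. \<eta> t) + \<gamma> * \<beta> / (2 * \<mu>) * (\<Sum>t=1..T-1. (\<sigma> t)\<^sup>2))"
    using \<mu>_pos \<zeta>_pos by (simp add: distrib_left)
  finally have "(\<Sum>t=1..T. D t) \<le> 1 / (2 * \<mu> * \<zeta>) * (F 1 x1 - Fstar 1)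
      + K / (\<mu> * \<zeta>) * (\<Sum>t=1..T-1. \<eta> t) + \<gamma> * \<beta> / (2 * \<mu>) * (\<Sum>t=1..T-1. (\<sigma> t)\<^sup>2)"
    using \<mu>_pos \<zeta>_pos by (subst (asm) mult_le_cancel_left_pos) simp_all
  moreover have "0 \<le> 1 / (4 * \<mu>\<^sup>2 * \<zeta>) * (\<Sum>t=1..T-1. (J (\<eta> t))\<^sup>2)"
    using \<zeta>_pos by (intro mult_nonneg_nonneg sum_nonneg) auto
  moreover have "dynamic_regret M F Fstar x T = (\<Sum>t=1..T. D t)"
    by (simp add: dynamic_regret_def D_def)
  moreover have "\<forall>t\<in>{1..T}. integrable M (\<lambda>\<omega>. F t (x t \<omega>) - Fstar t)"
    using F_int by auto
  ultimately show ?thesis by linarith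
qed

end
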